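(* Let $h$ and $p_0^*$ satisfy Assumptions (A1)–(A3) (given in the context), let $\beta>0$ and $T>0$. For a partition $0=t_0<t_1<\dots<t_{\bar N}=T$ with increments $\Delta t_n=t_n-t_{n-1}$, set $\rho_0=p_0^*$ and recursively let $\rho_n\in\mathcal P$ ($n=1,\dots,\bar N$) be the minimizer over $\rho\in\mathcal P$ of $$\mathsf I(\rho\mid\rho_{n-1})=\frac1{\Delta t_n}\mathsf D(\rho\mid\rho_{n-1})+\beta\int_{\mathbb R^d}h(x)\rho(x)\,dx .$$ Define $\rho^{(\bar N)}(x,t):=\rho_n(x)$ for $t\in[t_n,t_{n+1})$, $n=0,1,\dots,\bar N-1$. Then, in the limit as $\bar N\to\infty$ with $\max_n\Delta t_n\to0$, the density $\rho^{(\bar N)}(x,t)$ converges pointwise to a density $\rho(x,t)$ which is a weak solution of the replicator dynamics pde $$\frac{\partial\rho}{\partial t}(x,t)=-\beta\,(h(x)-\hat h_t)\,\rho(x,t),\qquad \rho(x,0)=p_0^*(x),$$ where $\hat h_t:=\int_{\mathbb R^d} h(x)\rho(x,t)\,dx$.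
   Context: $\mathcal P$ is the set of probability densities $\rho:\mathbb R^d\to[0,\infty)$ with $\int|x|^2\rho(x)\,dx<\infty$. $\mathsf D(\rho\mid\rho_{n-1})=\int\rho(x)\ln\big(\rho(x)/\rho_{n-1}(x)\big)\,dx$ is the Kullback–Leibler divergence. Assumptions. (A1) The prior density $p_0^*\in\mathcal P$ has the form $p_0^*(x)=e^{-V_0(x)}$ with $V_0\in C^2(\mathbb R^d)$, $D^2V_0\in L^\infty$, and $\liminf_{|x|\to\infty}\nabla V_0(x)\cdot\frac{x}{|x|}=\infty$. (A2) $h:\mathbb R^d\to\mathbb R$, $h\in C^2\cap L^2(\mathbb R^d;p_0^* )$ with $D^2h\in L^\infty$ and $\liminf_{|x|\to\infty}\nabla h(x)\cdot\frac{x}{|x|}>-\infty$. (A3) $h$ has a unique minimizer $\bar x\in\mathbb R^d$ with minimum value $\bar h=h(\bar x)$, and there exist a compact set $D\subset\mathbb R^d$ and $r>0$ with $h(x)>\bar h+r$ for all $x\in\mathbb R^d\setminus D$. Weak solution means: for every $C^1$ compactly supported $f$, $\int f(x)\rho(x,t)\,dx=\int f(x)p_0^*(x)\,dx-\beta\int_0^t\int (h(x)-\hat h_s)f(x)\rho(x,s)\,dx\,ds$. *)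

theory Defs
  imports "HOL-Analysis.Analysis"
begin

definition C1_fun :: "('a::euclidean_space \<Rightarrow> real) \<Rightarrow> bool" where
  "C1_fun f \<longleftrightarrow> (\<exists>g. (\<forall>x. GDERIV f x :> g x) \<and> continuous_on UNIV g)"

definition C2_fun_with ::
  "('a::euclidean_space \<Rightarrow> real) \<Rightarrow> ('a \<Rightarrow> 'a) \<Rightarrow> ('a \<Rightarrow> 'a \<Rightarrow>\<^sub>L 'a) \<Rightarrow> bool" where
  "C2_fun_with f g H \<longleftrightarrow>
     (\<forall>x. GDERIV f x :> g x) \<and>
     (\<forall>x. (g has_derivative blinfun_apply (H x)) (at x)) \<and>
     continuous_on UNIV H"

definition essentially_bounded :: "('a::euclidean_space \<Rightarrow> 'b::real_normed_vector) \<Rightarrow> bool" where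
  "essentially_bounded H \<longleftrightarrow> (\<exists>C. AE x in lborel. norm (H x) \<le> C)"

text \<open>Probability densities with respect to Lebesgue measure having a finite second moment.
  Members are functions, not classes modulo null sets.\<close>

definition densities2 :: "('a::euclidean_space \<Rightarrow> real) set" where
  "densities2 = {\<rho>. (\<forall>x. 0 \<le> \<rho> x) \<and> integrable lborel \<rho> \<and> (\<integral>x. \<rho> x \<partial>lborel) = 1 \<and>
                    integrable lborel (\<lambda>x. (norm x)\<^sup>2 * \<rho> x)}"

definition prior_assumption ::
  "('a::euclidean_space \<Rightarrow> real) \<Rightarrow> ('a \<Rightarrow> real) \<Rightarrow> bool" where
  "prior_assumption V0 p0 \<longleftrightarrow>
     p0 \<in> densities2 \<and> (\<forall>x. p0 x = exp (- V0 x)) \<and>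
     (\<exists>g H. C2_fun_with V0 g H \<and> essentially_bounded H \<and>
        Liminf at_infinity (\<lambda>x. ereal (g x \<bullet> (x /\<^sub>R norm x))) = \<infinity>)"

definition objective_assumption ::
  "('a::euclidean_space \<Rightarrow> real) \<Rightarrow> ('a \<Rightarrow> real) \<Rightarrow> bool" where
  "objective_assumption p0 h \<longleftrightarrow>
     integrable lborel (\<lambda>x. (h x)\<^sup>2 * p0 x) \<and>
     (\<exists>g H. C2_fun_with h g H \<and> essentially_bounded H \<and>
        Liminf at_infinity (\<lambda>x. ereal (g x \<bullet> (x /\<^sub>R norm x))) > - \<infinity>)"

definition minimizer_assumption :: "('a::euclidean_space \<Rightarrow> real) \<Rightarrow> bool" where
  "minimizer_assumption h \<longleftrightarrow>
     (\<exists>xbar. (\<forall>x. is_arg_min h (\<lambda>_. True) x \<longleftrightarrow> x = xbar) \<and>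
        (\<exists>D r. compact D \<and> 0 < r \<and> (\<forall>x. x \<notin> D \<longrightarrow> h xbar + r < h x)))"

text \<open>The integrand of the divergence, with the usual conventions \<open>0 ln (0/b) = 0\<close> and
  \<open>a ln (a/0) = \<infinity>\<close> for \<open>a > 0\<close>. The divergence takes values in the extended reals (as positive part
  minus negative part), so that a divergent integral counts as infinite; the real-valued
  \<open>KL_divergence\<close> of HOL-Probability would return \<open>0\<close> there and spoil the minimization below.
  For probability densities the negative part has a finite integral.\<close>

definition KL_integrand :: "real \<Rightarrow> real \<Rightarrow> ereal" where
  "KL_integrand a b =
     (if a = 0 then 0 else if b = 0 then \<infinity> else ereal (a * ln (a / b)))"

definition KL :: "('a::euclidean_space \<Rightarrow> real) \<Rightarrow> ('a \<Rightarrow> real) \<Rightarrow> ereal" where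
  "KL \<rho> \<sigma> =
     enn2ereal (\<integral>\<^sup>+x. e2ennreal (max 0 (KL_integrand (\<rho> x) (\<sigma> x))) \<partial>lborel) -
     enn2ereal (\<integral>\<^sup>+x. e2ennreal (max 0 (- KL_integrand (\<rho> x) (\<sigma> x))) \<partial>lborel)"

text \<open>The integral of \<open>h \<rho>\<close> exists for all \<open>\<rho> \<in> densities2\<close>, because a function with bounded
  Hessian grows at most quadratically.\<close>

definition step_functional ::
  "real \<Rightarrow> ('a::euclidean_space \<Rightarrow> real) \<Rightarrow> real \<Rightarrow> ('a \<Rightarrow> real) \<Rightarrow> ('a \<Rightarrow> real) \<Rightarrow> ereal" where
  "step_functional \<beta> h dt \<rho> \<sigma> =
     ereal (1 / dt) * KL \<rho> \<sigma> + ereal (\<beta> * (\<integral>x. h x * \<rho> x \<partial>lborel))"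

definition is_partition :: "real \<Rightarrow> nat \<Rightarrow> (nat \<Rightarrow> real) \<Rightarrow> bool" where
  "is_partition T N \<tau> \<longleftrightarrow> \<tau> 0 = 0 \<and> \<tau> N = T \<and> (\<forall>n<N. \<tau> n < \<tau> (Suc n))"

definition mesh :: "nat \<Rightarrow> (nat \<Rightarrow> real) \<Rightarrow> real" where
  "mesh N \<tau> = Max ((\<lambda>n. \<tau> (Suc n) - \<tau> n) ` {..<N})"

definition minimizing_scheme ::
  "real \<Rightarrow> ('a::euclidean_space \<Rightarrow> real) \<Rightarrow> ('a \<Rightarrow> real) \<Rightarrow> nat \<Rightarrow> (nat \<Rightarrow> real) \<Rightarrow>
   (nat \<Rightarrow> 'a \<Rightarrow> real) \<Rightarrow> bool" where
  "minimizing_scheme \<beta> h p0 N \<tau> q \<longleftrightarrow>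
     q 0 = p0 \<and>
     (\<forall>n<N. is_arg_min (\<lambda>\<rho>. step_functional \<beta> h (\<tau> (Suc n) - \<tau> n) \<rho> (q n))
              (\<lambda>\<rho>. \<rho> \<in> densities2) (q (Suc n)))"

text \<open>Meaningful only for times \<open>s\<close> in \<open>[0, T)\<close>, where the index is unique.\<close>

definition interpolant ::
  "nat \<Rightarrow> (nat \<Rightarrow> real) \<Rightarrow> (nat \<Rightarrow> 'a \<Rightarrow> real) \<Rightarrow> 'a \<Rightarrow> real \<Rightarrow> real" where
  "interpolant N \<tau> q x s = q (THE n. n < N \<and> \<tau> n \<le> s \<and> s < \<tau> (Suc n)) x"

definition mean_at :: "('a::euclidean_space \<Rightarrow> real) \<Rightarrow> ('a \<Rightarrow> real \<Rightarrow> real) \<Rightarrow> real \<Rightarrow> real" where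
  "mean_at h \<rho> s = (\<integral>x. h x * \<rho> x s \<partial>lborel)"

text \<open>The integrability clauses make all integrals in the weak formulation genuine (a Bochner
  integral of a non-integrable function would be \<open>0\<close>). The initial condition is the case \<open>t = 0\<close>.\<close>

definition weak_replicator_solution ::
  "real \<Rightarrow> ('a::euclidean_space \<Rightarrow> real) \<Rightarrow> ('a \<Rightarrow> real) \<Rightarrow> real \<Rightarrow> ('a \<Rightarrow> real \<Rightarrow> real) \<Rightarrow> bool" where
  "weak_replicator_solution \<beta> h p0 T \<rho> \<longleftrightarrow>
     (\<forall>t\<in>{0..<T}. integrable lborel (\<lambda>x. \<rho> x t) \<and> integrable lborel (\<lambda>x. h x * \<rho> x t)) \<and>
     (\<forall>f. C1_fun f \<and> compact (closure {x. f x \<noteq> 0}) \<longrightarrow>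
        (\<forall>t\<in>{0..<T}.
           set_integrable lborel {0..t}
             (\<lambda>s. \<integral>x. (h x - mean_at h \<rho> s) * f x * \<rho> x s \<partial>lborel) \<and>
           (\<integral>x. f x * \<rho> x t \<partial>lborel) =
             (\<integral>x. f x * p0 x \<partial>lborel) -
             \<beta> * (LINT s:{0..t}|lborel. (\<integral>x. (h x - mean_at h \<rho> s) * f x * \<rho> x s \<partial>lborel))))"

end

theory Submission
  imports Defs
begin

text \<open>The scheme can be solved in closed form. Write \<open>Z u = \<integral>p0 exp (- u h)\<close> and let
  \<open>tilt u = p0 exp (- u h) / Z u\<close> be the exponential family through the prior. Taking logarithms of
  \<open>tilt u\<close> and \<open>tilt (u + \<beta> dt)\<close> shows that, for every competitor \<open>\<rho>\<close>,
  \<open>D(\<rho> | tilt u) / dt + \<beta> \<integral>h \<rho> = D(\<rho> | tilt (u + \<beta> dt)) / dt + const\<close>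
  (lemma \<open>step_functional_tilt\<close>). The divergence is non-negative and vanishes exactly at its reference
  density, so a step that starts at \<open>tilt u\<close> has \<open>tilt (u + \<beta> dt)\<close> as its minimizer, unique up to
  null sets. By induction the \<open>n\<close>-th iterate is almost everywhere \<open>tilt (\<beta> t\<^sub>n)\<close>
  (lemma \<open>minimizing_scheme_AE_eq_tilt\<close>): it does not depend on how the interval up to \<open>t\<^sub>n\<close> was
  divided. Convergence of the interpolants to \<open>\<rho>(x, t) = tilt (\<beta> t) x\<close> is then just continuity
  of \<open>u \<mapsto> tilt u x\<close>. It holds at almost every \<open>x\<close>, and at every \<open>x\<close> if the iterates are
  chosen continuous, since continuous functions that agree almost everywhere are equal.

  That \<open>\<rho>\<close> solves the replicator equation is the formula
  \<open>d/du E\<^sub>u f = - E\<^sub>u ((h - E\<^sub>u h) f)\<close> for expectations under an exponential family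
  (lemma \<open>has_derivative_tilted_expectation\<close>), integrated in time.

  Three features of the data make the integrals behave. A function with bounded Hessian grows at most
  quadratically, so \<open>h \<rho>\<close> is integrable for every density with finite second moment. The existence
  of a minimizer bounds \<open>h\<close> from below, so \<open>exp (- u h)\<close> is bounded and all parameter
  integrals may be handled by dominated convergence. And the prior is strictly positive, so that
  divergences are taken against positive densities only.\<close>

section \<open>Continuity, null sets and quadratic growth\<close>

lemma AE_lborel_mem_closed:
  fixes S :: "'a::euclidean_space set"
  assumes "closed S" "AE x in lborel. x \<in> S"
  shows "x \<in> S"
  using mem_closed_if_AE_lebesgue[OF assms(1)] AE_completion[OF assms(2)] by blast

lemma continuous_AE_eq_imp_eq:
  fixes f g :: "'a::euclidean_space \<Rightarrow> real"
  assumes "continuous_on UNIV f" "continuous_on UNIV g" "AE x in lborel. f x = g x"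
  shows "f x = g x"
  using AE_lborel_mem_closed[OF closed_Collect_eq[OF assms(1,2)]] assms(3) by auto

lemma GDERIV_imp_continuous_on:
  fixes f :: "'a::euclidean_space \<Rightarrow> real"
  assumes "\<And>x. GDERIV f x :> g x"
  shows "continuous_on UNIV f"
  using assms has_derivative_continuous unfolding gderiv_def
  by (blast intro: continuous_at_imp_continuous_on)

text \<open>The Hessian bound holds almost everywhere and hence, by continuity, everywhere; integrating it
  twice from the origin gives linear growth of the gradient and then quadratic growth of the
  function.\<close>

lemma bounded_Hessian_imp_quadratic_growth:
  fixes f :: "'a::euclidean_space \<Rightarrow> real"
  assumes f: "C2_fun_with f g H" and H: "essentially_bounded H"
  obtains C where "\<And>x. \<bar>f x\<bar> \<le> C * (1 + (norm x)\<^sup>2)"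
proof -
  have grad: "\<And>x. (f has_derivative (\<lambda>v. v \<bullet> g x)) (at x)"
    and hess: "\<And>x. (g has_derivative blinfun_apply (H x)) (at x)"
    and cont: "continuous_on UNIV H"
    using f by (auto simp: C2_fun_with_def gderiv_def)
  obtain C where "AE x in lborel. norm (H x) \<le> C"
    using H by (auto simp: essentially_bounded_def)
  moreover have "closed {x. norm (H x) \<le> C}"
    by (intro closed_Collect_le continuous_intros cont)
  ultimately have C: "norm (H x) \<le> C" for x
    using AE_lborel_mem_closed[of "{x. norm (H x) \<le> C}" x] by simp
  have C0: "0 \<le> C" using C[of 0] norm_ge_zero[of "H 0"] by linarith
  have g: "norm (g x) \<le> norm (g 0) + C * norm x" for x
  proof -
    have "norm (g x - g 0) \<le> C * norm (x - 0)"
      by (rule differentiable_bound[of UNIV g "\<lambda>x. blinfun_apply (H x)"])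
         (use hess C in \<open>auto simp: norm_blinfun.rep_eq\<close>)
    then show ?thesis using norm_triangle_ineq2[of "g x" "g 0"] by simp
  qed
  define K where "K = \<bar>f 0\<bar> + norm (g 0) + C"
  show thesis
  proof (rule that)
    fix x
    have "norm (f x - f 0) \<le> (norm (g 0) + C * norm x) * norm (x - 0)"
    proof (rule differentiable_bound[of "cball 0 (norm x)" f "\<lambda>y v. v \<bullet> g y"])
      fix y :: 'a assume y: "y \<in> cball 0 (norm x)"
      show "onorm (\<lambda>v. v \<bullet> g y) \<le> norm (g 0) + C * norm x"
      proof (rule onorm_le)
        fix v
        have "norm (v \<bullet> g y) \<le> norm v * norm (g y)"
          by (simp add: Cauchy_Schwarz_ineq2)
        also have "\<dots> \<le> norm v * (norm (g 0) + C * norm x)"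
          using g[of y] mult_left_mono[of "norm y" "norm x" C] C0 y
          by (intro mult_left_mono) auto
        finally show "norm (v \<bullet> g y) \<le> (norm (g 0) + C * norm x) * norm v"
          by (simp add: mult.commute)
      qed
    next
      fix y :: 'a
      show "(f has_derivative (\<lambda>v. v \<bullet> g y)) (at y within cball 0 (norm x))"
        by (rule has_derivative_at_withinI[OF grad])
    qed auto
    then have "\<bar>f x\<bar> \<le> \<bar>f 0\<bar> + norm (g 0) * norm x + C * (norm x)\<^sup>2"
      by (simp add: algebra_simps power2_eq_square)
    moreover have "norm x \<le> 1 + (norm x)\<^sup>2"
      using sum_squares_bound[of "norm x" 1] norm_ge_zero[of x] by (simp only: one_power2)
    then have "norm (g 0) * norm x \<le> norm (g 0) * (1 + (norm x)\<^sup>2)"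
      by (intro mult_left_mono) auto
    moreover have "K * (1 + (norm x)\<^sup>2) = \<bar>f 0\<bar> + norm (g 0) * (1 + (norm x)\<^sup>2)
        + C * (norm x)\<^sup>2 + (\<bar>f 0\<bar> * (norm x)\<^sup>2 + C)"
      by (simp add: K_def algebra_simps)
    moreover have "0 \<le> \<bar>f 0\<bar> * (norm x)\<^sup>2 + C" using C0 by simp
    ultimately show "\<bar>f x\<bar> \<le> K * (1 + (norm x)\<^sup>2)" by linarith
  qed
qed

section \<open>The divergence against a positive density\<close>

text \<open>This is \<open>ln y \<le> y - 1\<close> at \<open>y = b / a\<close>, multiplied by \<open>a\<close>. Comparing with the difference
  \<open>a - b\<close> rather than with \<open>0\<close> makes the bound pointwise: for two probability densities
  the difference integrates to zero.\<close>

lemma log_ratio_lower_bound: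
  fixes a b :: real
  assumes "0 \<le> a" "0 < b"
  shows "a - b \<le> a * ln (a / b)"
proof (cases "a = 0")
  case False
  then have "a * ln (b / a) \<le> a * (b / a - 1)"
    using assms by (intro mult_left_mono ln_le_minus_one) auto
  moreover have "a * ln (b / a) = - (a * ln (a / b))" "a * (b / a - 1) = b - a"
    using assms False by (simp_all add: ln_div algebra_simps)
  ultimately show ?thesis by simp
qed (use assms in simp)

lemma log_ratio_eq_lower_bound:
  fixes a b :: real
  assumes "0 \<le> a" "0 < b" "a * ln (a / b) = a - b"
  shows "a = b"
proof -
  have "0 < a" using assms by (cases "a = 0") auto
  then have "a * ln (b / a) = - (a * ln (a / b))" "a * (b / a - 1) = b - a"
    using assms by (simp_all add: ln_div algebra_simps)
  then have "a * ln (b / a) = a * (b / a - 1)" using assms by simp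
  then have "ln (b / a) = b / a - 1" using \<open>0 < a\<close> by simp
  then have "b / a = 1" using assms \<open>0 < a\<close> ln_eq_minus_one[of "b / a"] by simp
  then show ?thesis using \<open>0 < a\<close> by simp
qed

lemma densities2D:
  assumes "\<rho> \<in> densities2"
  shows "0 \<le> \<rho> x" "integrable lborel \<rho>" "(\<integral>x. \<rho> x \<partial>lborel) = 1"
    "integrable lborel (\<lambda>x. (norm x)\<^sup>2 * \<rho> x)" "\<rho> \<in> borel_measurable borel"
  using assms borel_measurable_integrable[of lborel \<rho>] by (auto simp: densities2_def)

lemma KL_cong_AE:
  assumes "AE x in lborel. \<sigma> x = \<sigma>' x"
  shows "KL \<rho> \<sigma> = KL \<rho> \<sigma>'"
proof -
  have "(\<integral>\<^sup>+x. e2ennreal (max 0 (KL_integrand (\<rho> x) (\<sigma> x))) \<partial>lborel) =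
      (\<integral>\<^sup>+x. e2ennreal (max 0 (KL_integrand (\<rho> x) (\<sigma>' x))) \<partial>lborel)"
    using assms by (intro nn_integral_cong_AE) auto
  moreover have "(\<integral>\<^sup>+x. e2ennreal (max 0 (- KL_integrand (\<rho> x) (\<sigma> x))) \<partial>lborel) =
      (\<integral>\<^sup>+x. e2ennreal (max 0 (- KL_integrand (\<rho> x) (\<sigma>' x))) \<partial>lborel)"
    using assms by (intro nn_integral_cong_AE) auto
  ultimately show ?thesis by (simp add: KL_def)
qed

text \<open>Since \<open>a ln (a / b) \<ge> a - b \<ge> - b\<close>, the negative part of the integrand is dominated by the
  second density, so the divergence can fail to be a genuine integral only by being \<open>\<infinity>\<close>.\<close>

lemma KL_eq_integral:
  fixes \<rho> \<sigma> :: "'a::euclidean_space \<Rightarrow> real"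
  assumes \<rho>: "\<rho> \<in> densities2" and \<sigma>: "\<sigma> \<in> densities2" and pos: "\<And>x. 0 < \<sigma> x"
  shows "KL \<rho> \<sigma> = (if integrable lborel (\<lambda>x. \<rho> x * ln (\<rho> x / \<sigma> x))
    then ereal (\<integral>x. \<rho> x * ln (\<rho> x / \<sigma> x) \<partial>lborel) else \<infinity>)"
proof -
  let ?f = "\<lambda>x. \<rho> x * ln (\<rho> x / \<sigma> x)"
  note [measurable] = densities2D(5)[OF \<rho>] densities2D(5)[OF \<sigma>]
  have integrand: "KL_integrand (\<rho> x) (\<sigma> x) = ereal (?f x)" for x
    using pos[of x] by (auto simp: KL_integrand_def)
  have conv: "e2ennreal (max 0 (ereal r)) = ennreal r" for r
    by (cases "0 \<le> r") (auto simp: max_def e2ennreal_neg ennreal_neg)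
  have KL: "KL \<rho> \<sigma> = enn2ereal (\<integral>\<^sup>+x. ennreal (?f x) \<partial>lborel)
      - enn2ereal (\<integral>\<^sup>+x. ennreal (- ?f x) \<partial>lborel)"
    unfolding KL_def integrand by (simp only: conv uminus_ereal.simps)
  have "(\<integral>\<^sup>+x. ennreal (- ?f x) \<partial>lborel) \<le> (\<integral>\<^sup>+x. ennreal (\<sigma> x) \<partial>lborel)"
  proof (intro nn_integral_mono ennreal_leI)
    show "- ?f x \<le> \<sigma> x" for x
      using log_ratio_lower_bound[of "\<rho> x" "\<sigma> x"] densities2D(1)[OF \<rho>, of x] pos[of x] by linarith
  qed
  also have "\<dots> = ennreal 1"
    using densities2D[OF \<sigma>] by (simp add: nn_integral_eq_integral)
  finally have neg: "(\<integral>\<^sup>+x. ennreal (- ?f x) \<partial>lborel) \<noteq> \<infinity>"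
    by (auto simp: top_unique)
  show ?thesis
  proof (cases "integrable lborel ?f")
    case True
    then have "(\<integral>\<^sup>+x. ennreal (?f x) \<partial>lborel) \<noteq> \<infinity>" by (simp add: real_integrable_def)
    then show ?thesis
      using neg True unfolding KL real_lebesgue_integral_def[OF True]
      by (cases "\<integral>\<^sup>+x. ennreal (?f x) \<partial>lborel"; cases "\<integral>\<^sup>+x. ennreal (- ?f x) \<partial>lborel")
         (auto simp: enn2ereal_ennreal)
  next
    case False
    then have "(\<integral>\<^sup>+x. ennreal (?f x) \<partial>lborel) = \<infinity>"
      using neg by (auto simp: real_integrable_def)
    then show ?thesis
      using neg False unfolding KL
      by (cases "\<integral>\<^sup>+x. ennreal (- ?f x) \<partial>lborel") (auto simp: enn2ereal_ennreal)
  qed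
qed

lemma KL_nonneg_and_zero:
  fixes \<rho> \<sigma> :: "'a::euclidean_space \<Rightarrow> real"
  assumes \<rho>: "\<rho> \<in> densities2" and \<sigma>: "\<sigma> \<in> densities2" and pos: "\<And>x. 0 < \<sigma> x"
  shows KL_nonneg: "0 \<le> KL \<rho> \<sigma>"
    and KL_le_0_iff: "KL \<rho> \<sigma> \<le> 0 \<longleftrightarrow> (AE x in lborel. \<rho> x = \<sigma> x)"
proof -
  let ?f = "\<lambda>x. \<rho> x * ln (\<rho> x / \<sigma> x)"
  let ?d = "\<lambda>x. ?f x - (\<rho> x - \<sigma> x)"
  note [measurable] = densities2D(5)[OF \<rho>] densities2D(5)[OF \<sigma>]
  have d: "0 \<le> ?d x" for x
    using log_ratio_lower_bound[OF densities2D(1)[OF \<rho>] pos, of x] by simp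
  have d0: "?d x = 0 \<longleftrightarrow> \<rho> x = \<sigma> x" for x
    using log_ratio_eq_lower_bound[OF densities2D(1)[OF \<rho>, of x] pos[of x]] pos[of x] by auto
  \<comment> \<open>Both densities have mass one, so subtracting their difference does not change the integral
    but makes the integrand non-negative.\<close>
  have int: "integrable lborel ?d" "(\<integral>x. ?d x \<partial>lborel) = (\<integral>x. ?f x \<partial>lborel)"
    if "integrable lborel ?f"
    using that densities2D[OF \<rho>] densities2D[OF \<sigma>] by auto
  have "0 \<le> (\<integral>x. ?f x \<partial>lborel)" if "integrable lborel ?f"
    unfolding int(2)[OF that, symmetric] by (rule integral_nonneg_AE) (use d in simp)
  then show nonneg: "0 \<le> KL \<rho> \<sigma>" by (simp add: KL_eq_integral[OF assms])
  have zero: "(\<integral>x. ?f x \<partial>lborel) = 0 \<longleftrightarrow> (AE x in lborel. \<rho> x = \<sigma> x)" if "integrable lborel ?f"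
  proof -
    have "(\<integral>x. ?d x \<partial>lborel) = 0 \<longleftrightarrow> (AE x in lborel. ?d x = 0)"
      by (rule integral_nonneg_eq_0_iff_AE[OF int(1)[OF that]]) (intro AE_I2 d)
    then show ?thesis unfolding d0 int(2)[OF that] .
  qed
  have "integrable lborel ?f" if "AE x in lborel. \<rho> x = \<sigma> x"
  proof -
    have "AE x in lborel. ?f x = 0"
      using that by eventually_elim (use pos in \<open>simp add: less_imp_neq\<close>)
    then show ?thesis by (subst integrable_cong_AE[where g="\<lambda>_. 0"]) auto
  qed
  then show "KL \<rho> \<sigma> \<le> 0 \<longleftrightarrow> (AE x in lborel. \<rho> x = \<sigma> x)"
    using zero nonneg by (auto simp: KL_eq_integral[OF assms] split: if_splits)
qed

section \<open>Time partitions and test functions\<close>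

lemma partition_mono:
  assumes \<tau>: "is_partition T N \<tau>" and "m \<le> n" "n \<le> N"
  shows "\<tau> m \<le> \<tau> n"
  using assms(2,3)
proof (induction n rule: dec_induct)
  case (step n)
  then have "\<tau> m \<le> \<tau> n" "\<tau> n < \<tau> (Suc n)" using \<tau> by (auto simp: is_partition_def)
  then show ?case by simp
qed simp

lemma partition_nonneg:
  assumes \<tau>: "is_partition T N \<tau>" and "n \<le> N"
  shows "0 \<le> \<tau> n"
  using partition_mono[OF \<tau>, of 0 n] assms by (simp add: is_partition_def)

lemma partition_index_unique:
  assumes \<tau>: "is_partition T N \<tau>" and t: "t \<in> {0..<T}"
  shows "\<exists>!n. n < N \<and> \<tau> n \<le> t \<and> t < \<tau> (Suc n)"
proof (rule ex_ex1I)
  define m where "m = (LEAST m. t < \<tau> m)"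
  have "t < \<tau> N" using \<tau> t by (simp add: is_partition_def)
  then have m: "t < \<tau> m" "m \<le> N" unfolding m_def by (auto intro: LeastI Least_le)
  obtain n where n: "m = Suc n" using m(1) \<tau> t by (cases m) (auto simp: is_partition_def)
  have "\<tau> n \<le> t" using not_less_Least[of n "\<lambda>m. t < \<tau> m"] n by (simp add: m_def)
  then show "\<exists>n. n < N \<and> \<tau> n \<le> t \<and> t < \<tau> (Suc n)" using m n by (intro exI[of _ n]) auto
next
  fix n n' assume *: "n < N \<and> \<tau> n \<le> t \<and> t < \<tau> (Suc n)" "n' < N \<and> \<tau> n' \<le> t \<and> t < \<tau> (Suc n')"
  show "n = n'"
  proof (rule ccontr)
    assume "n \<noteq> n'"
    then consider "Suc n \<le> n'" | "Suc n' \<le> n" by linarith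
    then show False
      using * partition_mono[OF \<tau>, of "Suc n" n'] partition_mono[OF \<tau>, of "Suc n'" n]
      by cases auto
  qed
qed

lemma C1_compact_support_bounded:
  fixes f :: "'a::euclidean_space \<Rightarrow> real"
  assumes C1: "C1_fun f" and supp: "compact (closure {x. f x \<noteq> 0})"
  obtains B where "f \<in> borel_measurable borel" "\<And>x. \<bar>f x\<bar> \<le> B"
proof -
  have cont: "continuous_on UNIV f"
    using C1 by (auto simp: C1_fun_def intro: GDERIV_imp_continuous_on)
  have "bounded (f ` closure {x. f x \<noteq> 0})"
    by (intro compact_imp_bounded compact_continuous_image supp continuous_on_subset[OF cont]) auto
  then obtain B where B: "\<And>x. x \<in> closure {x. f x \<noteq> 0} \<Longrightarrow> \<bar>f x\<bar> \<le> B"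
    by (auto simp: bounded_iff)
  have "\<bar>f x\<bar> \<le> max B 0" for x
    using B[of x] closure_subset[of "{x. f x \<noteq> 0}"] by (cases "f x = 0") auto
  then show thesis using that borel_measurable_continuous_onI[OF cont] by blast
qed

section \<open>Exponential tilting\<close>

text \<open>The growth bound is matched to the finite second moment of the competitors; the constant \<open>c\<close>
  will be the minimum of \<open>h\<close>.\<close>

locale tilted_density =
  fixes p0 h :: "'a::euclidean_space \<Rightarrow> real" and c C :: real
  assumes prior: "p0 \<in> densities2"
    and prior_pos: "0 < p0 x"
    and continuous_prior: "continuous_on UNIV p0"
    and continuous_h: "continuous_on UNIV h"
    and h_lower: "c \<le> h x"
    and h_growth: "\<bar>h x\<bar> \<le> C * (1 + (norm x)\<^sup>2)"
begin

definition partition_function :: "real \<Rightarrow> real" where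
  "partition_function u = (\<integral>x. p0 x * exp (- (u * h x)) \<partial>lborel)"

definition tilt :: "real \<Rightarrow> 'a \<Rightarrow> real" where
  "tilt u x = p0 x * exp (- (u * h x)) / partition_function u"

lemma h_measurable [measurable]: "h \<in> borel_measurable borel"
  by (rule borel_measurable_continuous_onI[OF continuous_h])

lemma prior_measurable [measurable]: "p0 \<in> borel_measurable borel"
  by (rule densities2D(5)[OF prior])

text \<open>Every competitor is covered, so the linear term of the step functional is a genuine integral and
  never the default value \<open>0\<close> of a Bochner integral.\<close>

lemma integrable_h_densities2:
  assumes \<rho>: "\<rho> \<in> densities2"
  shows "integrable lborel (\<lambda>x. h x * \<rho> x)"
proof (rule Bochner_Integration.integrable_bound)
  note [measurable] = densities2D(5)[OF \<rho>]
  show "integrable lborel (\<lambda>x. C * (\<rho> x + (norm x)\<^sup>2 * \<rho> x))"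
    using densities2D[OF \<rho>] by auto
  show "(\<lambda>x. h x * \<rho> x) \<in> borel_measurable lborel" by measurable
  show "AE x in lborel. norm (h x * \<rho> x) \<le> norm (C * (\<rho> x + (norm x)\<^sup>2 * \<rho> x))"
  proof (rule AE_I2)
    fix x
    have "norm (h x * \<rho> x) \<le> C * (1 + (norm x)\<^sup>2) * \<rho> x"
      using mult_right_mono[OF h_growth[of x] densities2D(1)[OF \<rho>, of x]]
        densities2D(1)[OF \<rho>, of x] by (simp add: abs_mult)
    also have "\<dots> = C * (\<rho> x + (norm x)\<^sup>2 * \<rho> x)" by (simp add: algebra_simps)
    finally show "norm (h x * \<rho> x) \<le> norm (C * (\<rho> x + (norm x)\<^sup>2 * \<rho> x))" by simp
  qed
qed

text \<open>The lower bound on \<open>h\<close> makes the exponential factor bounded, uniformly for parameters in a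
  bounded interval. This is what supplies every dominating function below.\<close>

lemma exp_tilt_le:
  assumes "0 \<le> u" "u \<le> U"
  shows "exp (- (u * h x)) \<le> exp (U * \<bar>c\<bar>)"
proof -
  have "- (u * h x) \<le> u * \<bar>c\<bar>"
    using mult_left_mono[OF h_lower[of x] assms(1)] mult_left_mono[OF abs_ge_minus_self[of c] assms(1)]
    by simp
  also have "\<dots> \<le> U * \<bar>c\<bar>" using assms by (intro mult_right_mono) auto
  finally show ?thesis by simp
qed

lemma integrable_exp_tilt:
  assumes w: "integrable lborel w" and u: "0 \<le> u"
  shows "integrable lborel (\<lambda>x. w x * exp (- (u * h x)))"
proof (rule Bochner_Integration.integrable_bound)
  note [measurable] = borel_measurable_integrable[OF w]
  show "integrable lborel (\<lambda>x. exp (u * \<bar>c\<bar>) * w x)" using w by auto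
  show "(\<lambda>x. w x * exp (- (u * h x))) \<in> borel_measurable lborel" by measurable
  show "AE x in lborel. norm (w x * exp (- (u * h x))) \<le> norm (exp (u * \<bar>c\<bar>) * w x)"
    using mult_left_mono[OF exp_tilt_le[OF u order_refl] abs_ge_zero]
    by (intro AE_I2) (simp add: abs_mult mult.commute)
qed

lemma partition_function_pos:
  assumes "0 \<le> u"
  shows "0 < partition_function u"
proof -
  have int: "integrable lborel (\<lambda>x. p0 x * exp (- (u * h x)))"
    by (rule integrable_exp_tilt[OF densities2D(2)[OF prior] assms])
  have "\<not> (AE x in lborel. p0 x * exp (- (u * h x)) = 0)"
    using prior_pos AE_lborel_mem_closed[of "{} :: 'a set"] by (auto simp: less_imp_neq[symmetric])
  then have "partition_function u \<noteq> 0"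
    using integral_nonneg_eq_0_iff_AE[OF int] prior_pos
    by (simp add: partition_function_def less_imp_le)
  moreover have "0 \<le> partition_function u"
    unfolding partition_function_def
    by (rule integral_nonneg_AE) (simp add: prior_pos less_imp_le)
  ultimately show ?thesis by simp
qed

lemma partition_function_0: "partition_function 0 = 1"
  using densities2D(3)[OF prior] by (simp add: partition_function_def)

lemma tilt_0: "tilt 0 = p0"
  by (simp add: fun_eq_iff tilt_def partition_function_0)

lemma tilt_pos: "0 \<le> u \<Longrightarrow> 0 < tilt u x"
  using partition_function_pos prior_pos by (simp add: tilt_def)

lemma continuous_tilt: "0 \<le> u \<Longrightarrow> continuous_on UNIV (tilt u)"
  unfolding tilt_def using partition_function_pos[of u]
  by (intro continuous_intros continuous_prior continuous_h) auto

lemma tilt_in_densities2: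
  assumes "0 \<le> u"
  shows "tilt u \<in> densities2"
proof -
  note int = integrable_exp_tilt[OF densities2D(2)[OF prior] assms]
    integrable_exp_tilt[OF densities2D(4)[OF prior] assms]
  have "integrable lborel (tilt u)"
    unfolding tilt_def[abs_def] using int(1) by simp
  moreover have "(\<integral>x. tilt u x \<partial>lborel) = 1"
    using partition_function_pos[OF assms] by (simp add: tilt_def partition_function_def)
  moreover have "integrable lborel (\<lambda>x. (norm x)\<^sup>2 * tilt u x)"
    using integrable_divide[OF int(2), of "partition_function u"]
    by (simp add: tilt_def mult.assoc)
  ultimately show ?thesis
    using tilt_pos[OF assms] by (simp add: densities2_def less_imp_le)
qed

section \<open>One step of the scheme\<close>

text \<open>Completing the square: against a tilted density, the linear term \<open>\<beta> \<integral>h \<rho>\<close> only moves the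
  reference density of the divergence further along the same exponential family. The remaining term
  does not depend on \<open>\<rho>\<close>.\<close>

lemma step_functional_tilt:
  assumes \<rho>: "\<rho> \<in> densities2" and u: "0 \<le> u" and \<beta>: "0 < \<beta>" and dt: "0 < dt"
  defines "v \<equiv> u + \<beta> * dt"
  shows "step_functional \<beta> h dt \<rho> (tilt u) = ereal (1 / dt) * KL \<rho> (tilt v) +
    ereal (- ln (partition_function v / partition_function u) / dt)"
proof -
  have v: "0 \<le> v" using u \<beta> dt by (simp add: v_def)
  note Z = partition_function_pos[OF u] partition_function_pos[OF v]
  note [measurable] = densities2D(5)[OF \<rho>]
  let ?L = "ln (partition_function v / partition_function u)"
  let ?fu = "\<lambda>x. \<rho> x * ln (\<rho> x / tilt u x)"
  let ?fv = "\<lambda>x. \<rho> x * ln (\<rho> x / tilt v x)"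
  have pointwise: "?fu x = ?fv x - \<beta> * dt * (h x * \<rho> x) - ?L * \<rho> x" for x
  proof (cases "\<rho> x = 0")
    case False
    then have "0 < \<rho> x" using densities2D(1)[OF \<rho>, of x] by simp
    moreover have "ln (tilt w x) = ln (p0 x) - w * h x - ln (partition_function w)"
      if "0 \<le> w" for w
      using partition_function_pos[OF that] prior_pos[of x]
      by (simp add: tilt_def ln_div ln_mult_pos)
    ultimately show ?thesis
      using u v Z tilt_pos[OF u, of x] tilt_pos[OF v, of x]
      by (simp add: ln_div) (simp add: v_def algebra_simps)
  qed simp
  have lin: "integrable lborel (\<lambda>x. \<beta> * dt * (h x * \<rho> x))" "integrable lborel (\<lambda>x. ?L * \<rho> x)"
    using integrable_h_densities2[OF \<rho>] densities2D(2)[OF \<rho>] by auto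
  have pointwise_rev: "?fv x = ?fu x + \<beta> * dt * (h x * \<rho> x) + ?L * \<rho> x" for x
    using pointwise[of x] by simp
  have same: "integrable lborel ?fu \<longleftrightarrow> integrable lborel ?fv"
  proof
    assume "integrable lborel ?fu"
    then show "integrable lborel ?fv"
      unfolding pointwise_rev using lin by (intro Bochner_Integration.integrable_add)
  next
    assume "integrable lborel ?fv"
    then show "integrable lborel ?fu"
      unfolding pointwise using lin by (intro Bochner_Integration.integrable_diff)
  qed
  note KL = KL_eq_integral[OF \<rho> tilt_in_densities2[OF u] tilt_pos[OF u]]
    KL_eq_integral[OF \<rho> tilt_in_densities2[OF v] tilt_pos[OF v]]
  show ?thesis
  proof (cases "integrable lborel ?fv")
    case True
    then have "(\<integral>x. ?fu x \<partial>lborel) =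
        (\<integral>x. ?fv x \<partial>lborel) - \<beta> * dt * (\<integral>x. h x * \<rho> x \<partial>lborel) - ?L"
      unfolding pointwise using lin densities2D(3)[OF \<rho>] by simp
    then show ?thesis
      using True same dt by (simp add: step_functional_def KL field_simps)
  next
    case False
    then show ?thesis using same dt by (simp add: step_functional_def KL)
  qed
qed

lemma is_arg_min_step_tilt_iff:
  assumes u: "0 \<le> u" and \<beta>: "0 < \<beta>" and dt: "0 < dt"
  shows "is_arg_min (\<lambda>\<rho>. step_functional \<beta> h dt \<rho> (tilt u)) (\<lambda>\<rho>. \<rho> \<in> densities2) \<rho> \<longleftrightarrow>
    \<rho> \<in> densities2 \<and> (AE x in lborel. \<rho> x = tilt (u + \<beta> * dt) x)"
proof -
  define v where "v = u + \<beta> * dt"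
  have v: "0 \<le> v" using u \<beta> dt by (simp add: v_def)
  have less: "step_functional \<beta> h dt \<rho> (tilt u) < step_functional \<beta> h dt \<sigma> (tilt u) \<longleftrightarrow>
      KL \<rho> (tilt v) < KL \<sigma> (tilt v)" if "\<rho> \<in> densities2" "\<sigma> \<in> densities2" for \<rho> \<sigma>
    unfolding step_functional_tilt[OF that(1) u \<beta> dt] step_functional_tilt[OF that(2) u \<beta> dt]
      v_def[symmetric]
    using dt KL_nonneg[OF that(1) tilt_in_densities2[OF v] tilt_pos[OF v]]
      KL_nonneg[OF that(2) tilt_in_densities2[OF v] tilt_pos[OF v]]
    by (cases "KL \<rho> (tilt v)"; cases "KL \<sigma> (tilt v)") (auto simp: divide_strict_right_mono divide_less_cancel)
  have min: "0 \<le> KL \<sigma> (tilt v)" "KL \<sigma> (tilt v) \<le> 0 \<longleftrightarrow> (AE x in lborel. \<sigma> x = tilt v x)"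
    if "\<sigma> \<in> densities2" for \<sigma>
    using KL_nonneg[OF that tilt_in_densities2[OF v] tilt_pos[OF v]]
      KL_le_0_iff[OF that tilt_in_densities2[OF v] tilt_pos[OF v]] .
  have KL_tilt: "KL (tilt v) (tilt v) = 0"
    using min[OF tilt_in_densities2[OF v]] by (intro order_antisym) auto
  show ?thesis
    unfolding v_def[symmetric] is_arg_min_def
  proof (intro iffI conjI; (elim conjE)?)
    assume \<rho>: "\<rho> \<in> densities2" and "\<nexists>\<sigma>. \<sigma> \<in> densities2 \<and>
      step_functional \<beta> h dt \<sigma> (tilt u) < step_functional \<beta> h dt \<rho> (tilt u)"
    then have "\<not> 0 < KL \<rho> (tilt v)"
      using less[OF tilt_in_densities2[OF v] \<rho>] KL_tilt tilt_in_densities2[OF v] by auto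
    then show "AE x in lborel. \<rho> x = tilt v x" using min(2)[OF \<rho>] by (simp only: not_less)
  next
    assume \<rho>: "\<rho> \<in> densities2" and "AE x in lborel. \<rho> x = tilt v x"
    then have "KL \<rho> (tilt v) \<le> KL \<sigma> (tilt v)" if "\<sigma> \<in> densities2" for \<sigma>
      using min(1)[OF that] min(2)[OF \<rho>] by (meson order_trans)
    then show "\<nexists>\<sigma>. \<sigma> \<in> densities2 \<and>
      step_functional \<beta> h dt \<sigma> (tilt u) < step_functional \<beta> h dt \<rho> (tilt u)"
      using less[OF _ \<rho>] by (meson not_less)
  qed
qed

section \<open>The scheme runs along the exponential family\<close>

text \<open>The iterates are determined only up to null sets, but the step functional does not distinguish
  reference densities that agree almost everywhere, so the identity passes from one step to the
  next.\<close>

lemma minimizing_scheme_AE_eq_tilt: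
  assumes \<tau>: "is_partition T N \<tau>" and \<beta>: "0 < \<beta>"
    and q: "minimizing_scheme \<beta> h p0 N \<tau> q" and n: "n \<le> N"
  shows "AE x in lborel. q n x = tilt (\<beta> * \<tau> n) x"
  using n
proof (induction n)
  case 0
  then show ?case using q \<tau> by (simp add: minimizing_scheme_def is_partition_def tilt_0)
next
  case (Suc n)
  then have n: "n < N" and IH: "AE x in lborel. q n x = tilt (\<beta> * \<tau> n) x" by auto
  let ?dt = "\<tau> (Suc n) - \<tau> n"
  have "0 < ?dt" using \<tau> n by (simp add: is_partition_def)
  have "(\<lambda>\<rho>. step_functional \<beta> h ?dt \<rho> (q n)) =
      (\<lambda>\<rho>. step_functional \<beta> h ?dt \<rho> (tilt (\<beta> * \<tau> n)))"
    unfolding step_functional_def by (simp only: KL_cong_AE[OF IH])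
  moreover have "is_arg_min (\<lambda>\<rho>. step_functional \<beta> h ?dt \<rho> (q n))
      (\<lambda>\<rho>. \<rho> \<in> densities2) (q (Suc n))"
    using q n by (simp add: minimizing_scheme_def)
  moreover have "0 \<le> \<beta> * \<tau> n"
    using partition_nonneg[OF \<tau>] \<beta> n by simp
  ultimately have "AE x in lborel. q (Suc n) x = tilt (\<beta> * \<tau> n + \<beta> * ?dt) x"
    using is_arg_min_step_tilt_iff[OF _ \<beta> \<open>0 < ?dt\<close>] by simp
  then show ?case by (simp add: algebra_simps)
qed

lemma tilt_minimizing_scheme:
  assumes \<tau>: "is_partition T N \<tau>" and \<beta>: "0 < \<beta>"
  shows "minimizing_scheme \<beta> h p0 N \<tau> (\<lambda>n. tilt (\<beta> * \<tau> n))"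
  unfolding minimizing_scheme_def
proof (intro conjI allI impI)
  show "tilt (\<beta> * \<tau> 0) = p0" using \<tau> by (simp add: is_partition_def tilt_0)
  fix n assume n: "n < N"
  let ?dt = "\<tau> (Suc n) - \<tau> n"
  have dt: "0 < ?dt" using \<tau> n by (simp add: is_partition_def)
  have nonneg: "0 \<le> \<beta> * \<tau> n" "0 \<le> \<beta> * \<tau> (Suc n)"
    using partition_nonneg[OF \<tau>] \<beta> n by simp_all
  have "\<beta> * \<tau> n + \<beta> * ?dt = \<beta> * \<tau> (Suc n)" by (simp add: algebra_simps)
  then show "is_arg_min (\<lambda>\<rho>. step_functional \<beta> h ?dt \<rho> (tilt (\<beta> * \<tau> n)))
      (\<lambda>\<rho>. \<rho> \<in> densities2) (tilt (\<beta> * \<tau> (Suc n)))"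
    using is_arg_min_step_tilt_iff[OF nonneg(1) \<beta> dt] tilt_in_densities2[OF nonneg(2)] by simp
qed

section \<open>Differentiating in the tilting parameter\<close>

lemma continuous_on_integral_exp_tilt:
  assumes w: "integrable lborel w"
  shows "continuous_on {0..U} (\<lambda>u. \<integral>x. w x * exp (- (u * h x)) \<partial>lborel)"
proof (rule continuous_on_sequentiallyI)
  fix X and u :: real
  assume X: "\<forall>n. X n \<in> {0..U}" and lim: "X \<longlonglongrightarrow> u"
  note [measurable] = borel_measurable_integrable[OF w]
  show "(\<lambda>n. \<integral>x. w x * exp (- (X n * h x)) \<partial>lborel) \<longlonglongrightarrow>
      (\<integral>x. w x * exp (- (u * h x)) \<partial>lborel)"
  proof (rule integral_dominated_convergence[where w="\<lambda>x. exp (U * \<bar>c\<bar>) * \<bar>w x\<bar>"])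
    show "integrable lborel (\<lambda>x. exp (U * \<bar>c\<bar>) * \<bar>w x\<bar>)" using w by auto
    show "AE x in lborel. (\<lambda>n. w x * exp (- (X n * h x))) \<longlonglongrightarrow> w x * exp (- (u * h x))"
      by (intro AE_I2 tendsto_intros lim)
    show "AE x in lborel. norm (w x * exp (- (X n * h x))) \<le> exp (U * \<bar>c\<bar>) * \<bar>w x\<bar>" for n
      using mult_left_mono[OF exp_tilt_le[of "X n" U] abs_ge_zero] X
      by (intro AE_I2) (simp add: abs_mult mult.commute)
  qed measurable
qed

lemma has_derivative_integral_exp_tilt:
  assumes w: "integrable lborel w" and hw: "integrable lborel (\<lambda>x. h x * w x)"
    and u: "u \<in> {0..U}"
  shows "((\<lambda>u. \<integral>x. w x * exp (- (u * h x)) \<partial>lborel) has_real_derivative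
    - (\<integral>x. h x * w x * exp (- (u * h x)) \<partial>lborel)) (at u within {0..U})"
  unfolding has_field_derivative_iff tendsto_at_iff_sequentially o_def
proof (intro allI impI)
  fix X assume X: "\<forall>i. X i \<in> {0..U} - {u}" and lim: "X \<longlonglongrightarrow> u"
  note [measurable] = borel_measurable_integrable[OF w]
  let ?E = "\<lambda>u x. exp (- (u * h x))"
  let ?Q = "\<lambda>i x. w x * ((?E (X i) x - ?E u x) / (X i - u))"
  have deriv: "((\<lambda>u. ?E u x) has_real_derivative - h x * ?E v x) (at v within {0..U})" for v x
    by (auto intro!: derivative_eq_intros)
  have quotient: "((\<integral>x. w x * ?E (X i) x \<partial>lborel) - (\<integral>x. w x * ?E u x \<partial>lborel)) / (X i - u) =
      (\<integral>x. ?Q i x \<partial>lborel)" for i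
  proof -
    have "0 \<le> X i" "0 \<le> u" using X u by auto
    then have "((\<integral>x. w x * ?E (X i) x \<partial>lborel) - (\<integral>x. w x * ?E u x \<partial>lborel)) / (X i - u) =
        (\<integral>x. (w x * ?E (X i) x - w x * ?E u x) / (X i - u) \<partial>lborel)"
      by (subst integral_divide_zero, subst Bochner_Integration.integral_diff)
         (auto intro: integrable_exp_tilt w)
    then show ?thesis by (simp add: right_diff_distrib)
  qed
  have "(\<lambda>i. \<integral>x. ?Q i x \<partial>lborel) \<longlonglongrightarrow> (\<integral>x. w x * (- h x * ?E u x) \<partial>lborel)"
  proof (rule integral_dominated_convergence[where w="\<lambda>x. exp (U * \<bar>c\<bar>) * \<bar>h x * w x\<bar>"])
    show "integrable lborel (\<lambda>x. exp (U * \<bar>c\<bar>) * \<bar>h x * w x\<bar>)" using hw by auto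
    show "AE x in lborel. (\<lambda>i. ?Q i x) \<longlonglongrightarrow> w x * (- h x * ?E u x)"
      using deriv X lim unfolding has_field_derivative_iff tendsto_at_iff_sequentially o_def
      by (intro AE_I2 tendsto_mult tendsto_const) blast
    show "AE x in lborel. norm (?Q i x) \<le> exp (U * \<bar>c\<bar>) * \<bar>h x * w x\<bar>" for i
    proof (rule AE_I2)
      fix x
      \<comment> \<open>Mean value inequality: the derivative in the parameter is bounded on the whole interval.\<close>
      have "norm (?E (X i) x - ?E u x) \<le> (\<bar>h x\<bar> * exp (U * \<bar>c\<bar>)) * norm (X i - u)"
      proof (rule field_differentiable_bound[OF convex_real_interval(5) deriv])
        show "norm (- h x * ?E v x) \<le> \<bar>h x\<bar> * exp (U * \<bar>c\<bar>)" if "v \<in> {0..U}" for v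
          using that mult_left_mono[OF exp_tilt_le[of v U x] abs_ge_zero[of "h x"]]
          by (simp add: abs_mult)
      qed (use X u in auto)
      moreover have "X i - u \<noteq> 0" using X by auto
      ultimately have "\<bar>(?E (X i) x - ?E u x) / (X i - u)\<bar> \<le> \<bar>h x\<bar> * exp (U * \<bar>c\<bar>)"
        by (simp add: divide_le_eq)
      from mult_left_mono[OF this abs_ge_zero[of "w x"]]
      show "norm (?Q i x) \<le> exp (U * \<bar>c\<bar>) * \<bar>h x * w x\<bar>"
        by (simp add: abs_mult mult_ac)
    qed
  qed measurable
  moreover have "(\<integral>x. w x * (- h x * ?E u x) \<partial>lborel) = - (\<integral>x. h x * w x * ?E u x \<partial>lborel)"
    by (simp add: mult_ac flip: Bochner_Integration.integral_minus)
  ultimately show "(\<lambda>i. ((\<integral>x. w x * ?E (X i) x \<partial>lborel) - (\<integral>x. w x * ?E u x \<partial>lborel)) / (X i - u))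
      \<longlonglongrightarrow> - (\<integral>x. h x * w x * ?E u x \<partial>lborel)"
    unfolding quotient by simp
qed

lemma continuous_on_partition_function: "continuous_on {0..U} partition_function"
  using continuous_on_integral_exp_tilt[OF densities2D(2)[OF prior]]
  by (simp add: partition_function_def[abs_def])

lemma continuous_on_tilt_parameter: "continuous_on {0..U} (\<lambda>u. tilt u x)"
  unfolding tilt_def
  by (intro continuous_intros continuous_on_partition_function)
     (use partition_function_pos in \<open>auto simp: less_imp_neq[symmetric]\<close>)

text \<open>The covariance of \<open>h\<close> and \<open>f\<close> under \<open>tilt u\<close>: centring one of the two factors is enough. This
  form is the one in the weak formulation of the replicator equation.\<close>

definition tilted_covariance :: "('a \<Rightarrow> real) \<Rightarrow> real \<Rightarrow> real" where
  "tilted_covariance f u = (\<integral>x. (h x - (\<integral>y. h y * tilt u y \<partial>lborel)) * f x * tilt u x \<partial>lborel)"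

text \<open>Expectations under the tilted density are quotients of two parameter integrals; the quotient
  rule therefore produces the centring of \<open>h\<close>, with the partition function contributing the
  mean.\<close>

lemma tilted_expectation:
  assumes f: "integrable lborel (\<lambda>x. f x * p0 x)"
    and hf: "integrable lborel (\<lambda>x. h x * (f x * p0 x))"
  shows has_derivative_tilted_expectation:
      "u \<in> {0..U} \<Longrightarrow> ((\<lambda>u. \<integral>x. f x * tilt u x \<partial>lborel) has_real_derivative
        - tilted_covariance f u) (at u within {0..U})" (is "_ \<Longrightarrow> ?deriv u")
    and continuous_on_tilted_covariance: "continuous_on {0..U} (tilted_covariance f)"
proof -
  let ?I = "\<lambda>w u. \<integral>x. w x * exp (- (u * h x)) \<partial>lborel"
  let ?f = "\<lambda>x. f x * p0 x" and ?hf = "\<lambda>x. h x * (f x * p0 x)" and ?h = "\<lambda>x. h x * p0 x"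
  let ?Z = partition_function
  have Z: "?Z = ?I p0" by (simp add: partition_function_def[abs_def])
  note h = integrable_h_densities2[OF prior]
  have quotient: "(\<integral>x. g x * tilt u x \<partial>lborel) = ?I (\<lambda>x. g x * p0 x) u / ?Z u" for g u
    by (simp add: tilt_def mult.assoc)
  have cov: "tilted_covariance f u = (?I ?hf u - ?I ?h u / ?Z u * ?I ?f u) / ?Z u"
    if "0 \<le> u" for u
  proof -
    define m where "m = ?I ?h u / ?Z u"
    have "tilted_covariance f u =
        (\<integral>x. (?hf x * exp (- (u * h x)) - m * (?f x * exp (- (u * h x)))) / ?Z u \<partial>lborel)"
      unfolding tilted_covariance_def quotient m_def[symmetric]
      by (simp add: tilt_def algebra_simps)
    also have "\<dots> = (?I ?hf u - m * ?I ?f u) / ?Z u"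
      using integrable_exp_tilt[OF f that] integrable_exp_tilt[OF hf that]
      by (subst integral_divide_zero, subst Bochner_Integration.integral_diff) auto
    finally show ?thesis by (simp add: m_def)
  qed
  have pos: "?Z u \<noteq> 0" if "0 \<le> u" for u using partition_function_pos[OF that] by simp
  show "?deriv u" if "u \<in> {0..U}"
  proof -
    note D = has_derivative_integral_exp_tilt[OF f hf that]
      has_derivative_integral_exp_tilt[OF densities2D(2)[OF prior] h that, folded Z]
    show ?thesis
      unfolding quotient
    proof (rule DERIV_cong[OF DERIV_divide[OF D]])
      show "?Z u \<noteq> 0" using pos that by simp
      then show "(- ?I ?hf u * ?Z u - ?I ?f u * - ?I ?h u) / (?Z u * ?Z u) = - tilted_covariance f u"
        using that by (simp add: cov field_simps)
    qed
  qed
  have "continuous_on {0..U} (\<lambda>u. (?I ?hf u - ?I ?h u / ?Z u * ?I ?f u) / ?Z u)"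
    by (intro continuous_intros continuous_on_integral_exp_tilt f hf h continuous_on_partition_function)
       (use pos in auto)
  then show "continuous_on {0..U} (tilted_covariance f)"
    by (rule continuous_on_cong[THEN iffD1, rotated 2]) (auto simp: cov)
qed

section \<open>The limit dynamics\<close>

text \<open>The physical time is the tilting parameter up to the factor \<open>\<beta>\<close>, so the weak formulation is the
  fundamental theorem of calculus for \<open>t \<mapsto> \<integral>f tilt (\<beta> t)\<close>. Test functions enter only through
  boundedness, which keeps \<open>f p0\<close> and \<open>h f p0\<close> integrable.\<close>

lemma tilt_weak_replicator_solution:
  assumes \<beta>: "0 < \<beta>"
  shows "weak_replicator_solution \<beta> h p0 T (\<lambda>x t. tilt (\<beta> * t) x)"
  unfolding weak_replicator_solution_def
proof (intro conjI allI impI ballI; (elim conjE)?)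
  fix t assume "t \<in> {0..<T}"
  then have "0 \<le> \<beta> * t" using \<beta> by simp
  from tilt_in_densities2[OF this]
  show "integrable lborel (tilt (\<beta> * t))" "integrable lborel (\<lambda>x. h x * tilt (\<beta> * t) x)"
    by (auto intro: densities2D(2) integrable_h_densities2)
next
  fix f :: "'a \<Rightarrow> real" and t
  assume C1: "C1_fun f" and supp: "compact (closure {x. f x \<noteq> 0})" and "t \<in> {0..<T}"
  then have t: "0 \<le> t" by simp
  obtain B where f: "f \<in> borel_measurable borel" and B: "\<And>x. \<bar>f x\<bar> \<le> B"
    by (rule C1_compact_support_bounded[OF C1 supp]) blast
  note f[measurable]
  have int: "integrable lborel (\<lambda>x. f x * w x)" if w: "integrable lborel w" for w
  proof (rule Bochner_Integration.integrable_bound)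
    note [measurable] = borel_measurable_integrable[OF w]
    show "integrable lborel (\<lambda>x. B * w x)" using w by auto
    show "(\<lambda>x. f x * w x) \<in> borel_measurable lborel" by measurable
    show "AE x in lborel. norm (f x * w x) \<le> norm (B * w x)"
      using B by (intro AE_I2) (auto simp: abs_mult intro!: mult_right_mono order_trans[OF B abs_ge_self])
  qed
  note fp = int[OF densities2D(2)[OF prior]]
  have hfp: "integrable lborel (\<lambda>x. h x * (f x * p0 x))"
    using int[OF integrable_h_densities2[OF prior]] by (simp add: mult_ac)
  let ?F = "\<lambda>s. \<integral>x. f x * tilt (\<beta> * s) x \<partial>lborel"
  let ?cov = "\<lambda>s. tilted_covariance f (\<beta> * s)"
  have cov: "(\<integral>x. (h x - mean_at h (\<lambda>x t. tilt (\<beta> * t) x) s) * f x * tilt (\<beta> * s) x \<partial>lborel) = ?cov s"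
    for s by (simp add: tilted_covariance_def mean_at_def)
  have img: "(*) \<beta> ` {0..t} \<subseteq> {0..\<beta> * t}" using \<beta> by auto
  have cont: "continuous_on {0..t} ?cov"
    using continuous_on_compose2[OF continuous_on_tilted_covariance[OF fp hfp] _ img]
    by (auto intro: continuous_intros)
  show "set_integrable lborel {0..t}
      (\<lambda>s. \<integral>x. (h x - mean_at h (\<lambda>x t. tilt (\<beta> * t) x) s) * f x * tilt (\<beta> * s) x \<partial>lborel)"
    unfolding cov by (rule borel_integrable_atLeastAtMost'[OF cont])
  have deriv: "(?F has_vector_derivative - \<beta> * ?cov s) (at s within {0..t})"
    if "0 \<le> s" "s \<le> t" for s
  proof -
    have "\<beta> * s \<in> {0..\<beta> * t}" using that \<beta> by simp
    from DERIV_subset[OF has_derivative_tilted_expectation[OF fp hfp this] img]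
    have "((\<lambda>u. \<integral>x. f x * tilt u x \<partial>lborel) \<circ> (*) \<beta> has_real_derivative - ?cov s * \<beta>)
        (at s within {0..t})"
      by (rule DERIV_image_chain) (auto intro!: derivative_eq_intros)
    then show ?thesis
      by (simp add: o_def mult.commute has_real_derivative_iff_has_vector_derivative)
  qed
  have "(\<integral>s. indicator {0..t} s *\<^sub>R (- \<beta> * ?cov s) \<partial>lborel) = ?F t - ?F 0"
    by (rule integral_FTC_atLeastAtMost[OF t deriv]) (auto intro!: continuous_intros cont)
  moreover have "(\<integral>s. indicator {0..t} s *\<^sub>R (- \<beta> * ?cov s) \<partial>lborel) =
      - \<beta> * (LINT s:{0..t}|lborel. ?cov s)"
    unfolding set_lebesgue_integral_def
    by (simp add: mult.left_commute[of _ \<beta>])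
  ultimately show "?F t = (\<integral>x. f x * p0 x \<partial>lborel) - \<beta> * (LINT s:{0..t}|lborel.
      (\<integral>x. (h x - mean_at h (\<lambda>x t. tilt (\<beta> * t) x) s) * f x * tilt (\<beta> * s) x \<partial>lborel))"
    unfolding cov by (simp add: tilt_0)
qed

text \<open>At time \<open>t\<close> the interpolant is the tilted density at the left end of the cell containing
  \<open>t\<close>, which is at distance at most the mesh from \<open>t\<close>.\<close>

lemma interpolant_tendsto_tilt:
  assumes \<tau>: "\<And>k. is_partition T (N k) (\<tau> k)" and mesh: "(\<lambda>k. mesh (N k) (\<tau> k)) \<longlonglongrightarrow> 0"
    and \<beta>: "0 < \<beta>" and t: "t \<in> {0..<T}"
    and q: "\<And>k n. n \<le> N k \<Longrightarrow> q k n x = tilt (\<beta> * \<tau> k n) x"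
  shows "(\<lambda>k. interpolant (N k) (\<tau> k) (q k) x t) \<longlonglongrightarrow> tilt (\<beta> * t) x"
proof -
  define i where "i k = (THE n. n < N k \<and> \<tau> k n \<le> t \<and> t < \<tau> k (Suc n))" for k
  have i: "i k < N k" "\<tau> k (i k) \<le> t" "t < \<tau> k (Suc (i k))" for k
    using theI'[OF partition_index_unique[OF \<tau> t], of k] by (auto simp: i_def)
  have close: "t - \<tau> k (i k) \<le> mesh (N k) (\<tau> k)" for k
  proof -
    have "\<tau> k (Suc (i k)) - \<tau> k (i k) \<le> mesh (N k) (\<tau> k)"
      unfolding mesh_def using i(1) by (intro Max_ge) auto
    then show ?thesis using i(3)[of k] by linarith
  qed
  have "(\<lambda>k. t - \<tau> k (i k)) \<longlonglongrightarrow> 0"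
    by (rule real_tendsto_sandwich[OF _ _ tendsto_const mesh]) (use i close in auto)
  then have "(\<lambda>k. t - (t - \<tau> k (i k))) \<longlonglongrightarrow> t - 0" by (intro tendsto_intros)
  then have lim: "(\<lambda>k. \<beta> * \<tau> k (i k)) \<longlonglongrightarrow> \<beta> * t" by (intro tendsto_intros) simp
  have "(\<lambda>k. tilt (\<beta> * \<tau> k (i k)) x) \<longlonglongrightarrow> tilt (\<beta> * t) x"
  proof (rule continuous_on_tendsto_compose[OF continuous_on_tilt_parameter[of "\<beta> * t"] lim])
    show "\<beta> * t \<in> {0..\<beta> * t}" using \<beta> t by simp
    show "\<forall>\<^sub>F k in sequentially. \<beta> * \<tau> k (i k) \<in> {0..\<beta> * t}"
      using i(1,2) partition_nonneg[OF \<tau>] \<beta> by (intro always_eventually) (auto simp: less_imp_le)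
  qed
  moreover have "interpolant (N k) (\<tau> k) (q k) x t = tilt (\<beta> * \<tau> k (i k)) x" for k
    using q[OF less_imp_le[OF i(1)]] by (simp add: interpolant_def i_def)
  ultimately show ?thesis by simp
qed

end

section \<open>Convergence of the scheme\<close>

theorem theorem1:
  fixes V0 p0 h :: "'a::euclidean_space \<Rightarrow> real" and \<beta> T :: real
  assumes "prior_assumption V0 p0"
    and "objective_assumption p0 h"
    and "minimizer_assumption h"
    and "0 < \<beta>"
    and "0 < T"
  shows
    "(\<forall>N \<tau>. is_partition T N \<tau> \<longrightarrow>
        (\<exists>q. minimizing_scheme \<beta> h p0 N \<tau> q \<and> (\<forall>n\<le>N. continuous_on UNIV (q n))) \<and>
        (\<forall>q q'. minimizing_scheme \<beta> h p0 N \<tau> q \<longrightarrow> minimizing_scheme \<beta> h p0 N \<tau> q' \<longrightarrow>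
           (\<forall>n\<le>N. AE x in lborel. q n x = q' n x))) \<and>
     (\<exists>\<rho> :: 'a \<Rightarrow> real \<Rightarrow> real.
        (\<forall>t\<in>{0..<T}. (\<lambda>x. \<rho> x t) \<in> densities2) \<and>
        weak_replicator_solution \<beta> h p0 T \<rho> \<and>
        (\<forall>N \<tau> q.
           (\<forall>k. is_partition T (N k) (\<tau> k)) \<longrightarrow>
           filterlim N at_top sequentially \<longrightarrow>
           (\<lambda>k. mesh (N k) (\<tau> k)) \<longlonglongrightarrow> 0 \<longrightarrow>
           (\<forall>k. minimizing_scheme \<beta> h p0 (N k) (\<tau> k) (q k)) \<longrightarrow>
           (AE x in lborel. \<forall>t\<in>{0..<T}.
              (\<lambda>k. interpolant (N k) (\<tau> k) (q k) x t) \<longlonglongrightarrow> \<rho> x t) \<and>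
           ((\<forall>k. \<forall>n\<le>N k. continuous_on UNIV (q k n)) \<longrightarrow>
              (\<forall>x. \<forall>t\<in>{0..<T}.
                 (\<lambda>k. interpolant (N k) (\<tau> k) (q k) x t) \<longlonglongrightarrow> \<rho> x t))))"
proof -
  obtain g H where p0: "p0 \<in> densities2" "\<And>x. p0 x = exp (- V0 x)" and V0: "C2_fun_with V0 g H"
    using assms(1) by (auto simp: prior_assumption_def)
  obtain g' H' where h: "C2_fun_with h g' H'" "essentially_bounded H'"
    using assms(2) by (auto simp: objective_assumption_def)
  obtain xbar where "is_arg_min h (\<lambda>_. True) xbar"
    using assms(3) by (auto simp: minimizer_assumption_def)
  then have lower: "h xbar \<le> h x" for x by (auto simp: is_arg_min_def not_less)
  obtain C where growth: "\<And>x. \<bar>h x\<bar> \<le> C * (1 + (norm x)\<^sup>2)"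
    by (rule bounded_Hessian_imp_quadratic_growth[OF h]) blast
  have cont: "continuous_on UNIV f" if "C2_fun_with f g H" for f :: "'a \<Rightarrow> real" and g H
    using that by (auto simp: C2_fun_with_def intro: GDERIV_imp_continuous_on)
  have "continuous_on UNIV (\<lambda>x. exp (- V0 x))" by (intro continuous_intros cont[OF V0])
  then have "continuous_on UNIV p0" by (simp add: p0(2)[abs_def] fun_eq_iff cong: continuous_on_cong)
  then interpret tilted_density p0 h "h xbar" C
    by unfold_locales (use p0 cont[OF h(1)] lower growth in auto)
  note \<beta> = \<open>0 < \<beta>\<close>
  let ?\<rho> = "\<lambda>x t. tilt (\<beta> * t) x"
  show ?thesis
  proof (intro conjI allI impI exI[of _ ?\<rho>])
    fix N \<tau> assume \<tau>: "is_partition T N \<tau>"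
    show "\<exists>q. minimizing_scheme \<beta> h p0 N \<tau> q \<and> (\<forall>n\<le>N. continuous_on UNIV (q n))"
      using tilt_minimizing_scheme[OF \<tau> \<beta>] partition_nonneg[OF \<tau>] \<beta>
      by (intro exI[of _ "\<lambda>n. tilt (\<beta> * \<tau> n)"]) (auto intro!: continuous_tilt)
    fix q q' n assume q: "minimizing_scheme \<beta> h p0 N \<tau> q" "minimizing_scheme \<beta> h p0 N \<tau> q'"
      and n: "n \<le> N"
    show "AE x in lborel. q n x = q' n x"
      using minimizing_scheme_AE_eq_tilt[OF \<tau> \<beta> q(1) n] minimizing_scheme_AE_eq_tilt[OF \<tau> \<beta> q(2) n]
      by eventually_elim simp
  next
    show "\<forall>t\<in>{0..<T}. tilt (\<beta> * t) \<in> densities2"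
      using \<beta> by (auto intro!: tilt_in_densities2)
    show "weak_replicator_solution \<beta> h p0 T ?\<rho>"
      by (rule tilt_weak_replicator_solution[OF \<beta>])
  next
    fix N \<tau> q
    assume \<tau>: "\<forall>k. is_partition T (N k) (\<tau> k)" and mesh: "(\<lambda>k. mesh (N k) (\<tau> k)) \<longlonglongrightarrow> 0"
      and q: "\<forall>k. minimizing_scheme \<beta> h p0 (N k) (\<tau> k) (q k)"
    note lim = interpolant_tendsto_tilt[OF \<tau>[rule_format] mesh \<beta>]
    have AE: "AE x in lborel. n \<le> N k \<longrightarrow> q k n x = tilt (\<beta> * \<tau> k n) x" for k n
      using minimizing_scheme_AE_eq_tilt[OF \<tau>[rule_format] \<beta> q[rule_format], of n k]
      by (cases "n \<le> N k") auto
    \<comment> \<open>The exceptional sets are indexed by the countably many pairs \<open>(k, n)\<close> and not by the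
      time, so one null set serves all \<open>t\<close>.\<close>
    then have "AE x in lborel. \<forall>k n. n \<le> N k \<longrightarrow> q k n x = tilt (\<beta> * \<tau> k n) x"
      by (simp add: AE_all_countable)
    then show "AE x in lborel. \<forall>t\<in>{0..<T}.
        (\<lambda>k. interpolant (N k) (\<tau> k) (q k) x t) \<longlonglongrightarrow> tilt (\<beta> * t) x"
      by eventually_elim (intro ballI lim, auto)
    fix x
    assume qc: "\<forall>k. \<forall>n\<le>N k. continuous_on UNIV (q k n)"
    have "q k n x = tilt (\<beta> * \<tau> k n) x" if n: "n \<le> N k" for k n
    proof (rule continuous_AE_eq_imp_eq[where f="q k n"])
      show "continuous_on UNIV (q k n)" using qc n by blast
      show "continuous_on UNIV (tilt (\<beta> * \<tau> k n))"
        using partition_nonneg[OF \<tau>[rule_format] n] \<beta> by (intro continuous_tilt) simp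
      show "AE x in lborel. q k n x = tilt (\<beta> * \<tau> k n) x" using AE[of n k] n by simp
    qed
    then show "\<forall>t\<in>{0..<T}. (\<lambda>k. interpolant (N k) (\<tau> k) (q k) x t) \<longlonglongrightarrow> tilt (\<beta> * t) x"
      by (intro ballI lim)
  qed
qed

end
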